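(* Let $\mathcal{M}$ be a class of finite groups containing all finite direct products of distinct extraspecial groups of the form $M_{p^3}$, where $p$ is an odd prime (that is, all groups $M_{q_1^3}\times\cdots\times M_{q_r^3}$ with $q_1,\ldots,q_r$ pairwise distinct odd primes). Then the set $CD_{\mathcal{M}}=\{\mathrm{cdeg}(G)\mid G\in\mathcal{M}\}$ is dense in $[0,1]$.
   Context: For an odd prime $p$, $M_{p^3}=\langle x,y\mid x^{p^2}=y^p=1,\ y^{-1}xy=x^{p+1}\rangle$ is the modular $p$-group of order $p^3$. For a finite group $G$, the cyclicity degree of $G$ is $\mathrm{cdeg}(G)=\frac{|C(G)|}{|L(G)|}$, where $C(G)$ is the set of cyclic subgroups of $G$ and $L(G)$ is the set of all subgroups of $G$. Density in $[0,1]$ is with respect to the usual topology of $\mathbb{R}$. *)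

theory Defs
  imports "HOL-Analysis.Analysis" "HOL-Algebra.Product_Groups"
begin

text \<open>
  A word in the generators \<open>'g\<close> and their formal inverses: the letter \<open>(g, True)\<close> stands for
  \<open>g\<close>, and \<open>(g, False)\<close> for the inverse of \<open>g\<close>. A set of pairs \<open>(u, v)\<close> of words represents
  the defining relations \<open>u = v\<close>.
\<close>

type_synonym 'g word = "('g \<times> bool) list"

text \<open>
  The least congruence on the free monoid of words that contains the relations and makes
  \<open>(g, True)\<close> and \<open>(g, False)\<close> mutually inverse.
\<close>

inductive word_eq :: "('g word \<times> 'g word) set \<Rightarrow> 'g word \<Rightarrow> 'g word \<Rightarrow> bool"
  for R where
  rel: "(u, v) \<in> R \<Longrightarrow> word_eq R u v"
| cancel: "word_eq R [(g, b), (g, \<not> b)] []"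
| refl: "word_eq R u u"
| sym: "word_eq R u v \<Longrightarrow> word_eq R v u"
| trans: "word_eq R u v \<Longrightarrow> word_eq R v w \<Longrightarrow> word_eq R u w"
| append: "word_eq R u u' \<Longrightarrow> word_eq R v v' \<Longrightarrow> word_eq R (u @ v) (u' @ v')"

text \<open>The generating set of the presentation is the whole type \<open>'g\<close>.\<close>

definition presented_group :: "('g word \<times> 'g word) set \<Rightarrow> 'g word set monoid" where
  "presented_group R =
     \<lparr>carrier = UNIV // {(u, v). word_eq R u v},
      monoid.mult = (\<lambda>A B. {w. \<exists>u\<in>A. \<exists>v\<in>B. word_eq R (u @ v) w}),
      one = {w. word_eq R [] w}\<rparr>"

lemma presented_group_mult:
  "{w. word_eq R u w} \<otimes>\<^bsub>presented_group R\<^esub> {w. word_eq R v w} = {w. word_eq R (u @ v) w}"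
  unfolding presented_group_def
  by (auto intro: word_eq.refl word_eq.trans[OF word_eq.append])

lemma presented_group_carrier:
  "carrier (presented_group R) = range (\<lambda>u. {w. word_eq R u w})"
  unfolding presented_group_def quotient_def by auto

lemma word_eq_inverse: "word_eq R (map (\<lambda>(g, b). (g, \<not> b)) (rev u) @ u) []"
proof (induction u)
  case Nil
  show ?case by (simp add: word_eq.refl)
next
  case (Cons a u)
  obtain g b where a: "a = (g, b)" by (cases a)
  let ?v = "map (\<lambda>(g, b). (g, \<not> b)) (rev u)"
  have "word_eq R [(g, \<not> b), (g, b)] []"
    using word_eq.cancel[of R g "\<not> b"] by simp
  then have "word_eq R (?v @ [(g, \<not> b), (g, b)] @ u) (?v @ [] @ u)"
    by (intro word_eq.append word_eq.refl)
  with Cons.IH a show ?case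
    by (auto intro: word_eq.trans)
qed

lemma group_presented_group: "group (presented_group R)"
proof (rule groupI)
  have one: "\<one>\<^bsub>presented_group R\<^esub> = {w. word_eq R [] w}"
    by (simp add: presented_group_def)
  then show "\<one>\<^bsub>presented_group R\<^esub> \<in> carrier (presented_group R)"
    by (auto simp: presented_group_carrier)
  show "\<one>\<^bsub>presented_group R\<^esub> \<otimes>\<^bsub>presented_group R\<^esub> x = x"
    if "x \<in> carrier (presented_group R)" for x
    using that by (auto simp: presented_group_carrier presented_group_mult one)
  show "\<exists>y\<in>carrier (presented_group R). y \<otimes>\<^bsub>presented_group R\<^esub> x = \<one>\<^bsub>presented_group R\<^esub>"
    if x: "x \<in> carrier (presented_group R)" for x
  proof -
    obtain u where u: "x = {w. word_eq R u w}" using x by (auto simp: presented_group_carrier)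
    let ?v = "map (\<lambda>(g, b). (g, \<not> b)) (rev u)"
    have "{w. word_eq R (?v @ u) w} = {w. word_eq R [] w}"
      using word_eq_inverse[of R u] by (auto intro: word_eq.sym word_eq.trans)
    then have "{w. word_eq R ?v w} \<otimes>\<^bsub>presented_group R\<^esub> x = \<one>\<^bsub>presented_group R\<^esub>"
      by (simp only: u one presented_group_mult)
    then show ?thesis by (auto simp: presented_group_carrier)
  qed
qed (auto simp: presented_group_carrier presented_group_mult)

datatype modular_gen = Gen_x | Gen_y

abbreviation "letter_x \<equiv> (Gen_x, True)"
abbreviation "letter_y \<equiv> (Gen_y, True)"
abbreviation "letter_y_inv \<equiv> (Gen_y, False)"

definition modular_p3 :: "nat \<Rightarrow> modular_gen word set monoid" where
  "modular_p3 p = presented_group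
     {(replicate (p^2) letter_x, []),
      (replicate p letter_y, []),
      ([letter_y_inv, letter_x, letter_y], replicate (p + 1) letter_x)}"

text \<open>For a subgroup \<open>H\<close> of \<open>G\<close>, \<open>subgroup_generated G H\<close> is \<open>H\<close> regarded as a group.\<close>

definition cyclic_subgroups :: "'a monoid \<Rightarrow> 'a set set" where
  "cyclic_subgroups G = {H. subgroup H G \<and> cyclic_group (subgroup_generated G H)}"

definition cdeg :: "'a monoid \<Rightarrow> real" where
  "cdeg G = card (cyclic_subgroups G) / card {H. subgroup H G}"

definition CD :: "'a monoid set \<Rightarrow> real set" where
  "CD M = {cdeg G | G. G \<in> M}"

end

theory Submission
  imports Defs "HOL-Algebra.Multiplicative_Group" "HOL-Number_Theory.Totient"
begin

text \<open>
  The only non-cyclic subgroups of \<open>M\<close> of order \<open>p\<^sup>3\<close> are \<open>M\<close> itself and the elementary abelian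
  group of elements with \<open>x\<^sup>p = 1\<close>, while counting elements by their order gives \<open>1\<close>, \<open>p + 1\<close>
  and \<open>p\<close> cyclic subgroups of order \<open>1\<close>, \<open>p\<close> and \<open>p\<^sup>2\<close>. Hence the cyclicity degree is
  \<open>(2 p + 2) / (2 p + 4)\<close>. Subgroups of a product of groups of coprime orders are products of
  subgroups, so that the cyclicity degree is multiplicative. The products of the factors
  \<open>(q + 1) / (q + 2)\<close> over primes are dense because the factors tend to 1 while their infinite
  product vanishes: \<open>((q + 1) / (q + 2))\<^sup>2 \<le> 1 - 1 / q\<close>, and by Euler's argument
  \<open>\<Prod>\<^sub>p 1 / (1 - 1 / p)\<close> dominates the harmonic series.
\<close>

section \<open>Cyclicity degrees and coprime products\<close>

text \<open>Describes cyclic subgroups through generators in the ambient group, so that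
  homomorphisms and products can be applied to single elements. Integer powers, and hence cyclicity,
  are the same in \<open>H\<close> as in \<open>G\<close>.\<close>

lemma cyclic_subgroups_eq:
  fixes G (structure)
  assumes "group G"
  shows "cyclic_subgroups G = (\<lambda>x. generate G {x}) ` carrier G"
proof -
  interpret group G by fact
  have "cyclic_group (subgroup_generated G H) \<longleftrightarrow> (\<exists>x\<in>H. generate G {x} = H)" if "subgroup H G" for H
  proof -
    have H: "carrier (subgroup_generated G H) = H"
      using that by (rule subgroup.carrier_subgroup_generated_subgroup)
    have gen: "generate G {x} = range (\<lambda>n::int. x [^]\<^bsub>subgroup_generated G H\<^esub> n)" if "x \<in> H" for x
      using that H \<open>subgroup H G\<close> generate_pow[of x] int_pow_subgroup_generated[of x H]
      by (auto dest: subgroup.mem_carrier)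
    then show ?thesis
      unfolding group.cyclic_group[OF group_subgroup_generated] H
      by (intro bex_cong refl) (auto simp: gen)
  qed
  moreover have "x \<in> generate G {x}" for x by (simp add: generate.incl)
  moreover have "subgroup (generate G {x}) G" if "x \<in> carrier G" for x
    using that by (simp add: generate_is_subgroup)
  ultimately show ?thesis
    unfolding cyclic_subgroups_def by (auto dest: subgroup.mem_carrier)
qed

lemma (in group) finite_subgroups:
  assumes "finite (carrier G)"
  shows "finite {H. subgroup H G}"
  by (rule finite_subset[of _ "Pow (carrier G)"]) (use assms subgroup.subset in auto)

lemma cdeg_bounds:
  fixes G (structure)
  assumes "group G" "finite (carrier G)"
  shows "cdeg G \<in> {0..1}"
proof -
  interpret group G by fact
  have "card (cyclic_subgroups G) \<le> card {H. subgroup H G}"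
    by (rule card_mono[OF finite_subgroups[OF assms(2)]]) (auto simp: cyclic_subgroups_def)
  then show ?thesis by (auto simp: cdeg_def divide_le_eq_1)
qed

text \<open>Taking images under an isomorphism is a bijection between the subgroups that sends
  \<open>generate G {x}\<close> to \<open>generate H {h x}\<close>, so both counts agree. The groups
  may live on different types, which permits the passage from word classes to pairs of
  numbers.\<close>

lemma iso_imp_cdeg_eq:
  assumes "group G" "group H" "G \<cong> H"
  shows "cdeg G = cdeg H"
proof -
  interpret G: group G by fact
  interpret H: group H by fact
  obtain h where "h \<in> iso G H" using assms(3) by (auto simp: is_iso_def)
  then obtain g where hg: "group_isomorphisms G H h g"
    using G.iso_iff_group_isomorphisms by blast
  interpret h: group_hom G H h
    using hg by unfold_locales (simp add: group_isomorphisms_def)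
  interpret g: group_hom H G g
    using hg by unfold_locales (simp add: group_isomorphisms_def)
  have gh: "g (h x) = x" if "x \<in> carrier G" for x
    using hg that by (simp add: group_isomorphisms_def)
  have hg: "h (g y) = y" if "y \<in> carrier H" for y
    using hg that by (simp add: group_isomorphisms_def)
  have hgK: "h ` g ` K = K" if "K \<subseteq> carrier H" for K
  proof -
    have "h ` g ` K = (\<lambda>y. y) ` K"
      unfolding image_image by (intro image_cong refl) (use hg that in auto)
    then show ?thesis by simp
  qed
  have inj: "inj_on ((`) h) (Pow (carrier G))"
    by (rule inj_on_image_Pow) (metis gh inj_onI)
  have "{K. subgroup K H} = (`) h ` {K. subgroup K G}"
  proof (intro equalityI subsetI)
    fix K assume "K \<in> {K. subgroup K H}"
    then have "K \<subseteq> carrier H" "subgroup (g ` K) G"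
      using subgroup.subset g.subgroup_img_is_subgroup by auto
    then show "K \<in> (`) h ` {K. subgroup K G}"
      using hgK by blast
  qed (auto intro: h.subgroup_img_is_subgroup)
  moreover have "inj_on ((`) h) {K. subgroup K G}"
    by (rule inj_on_subset[OF inj]) (auto dest: subgroup.subset)
  ultimately have 1: "card {K. subgroup K H} = card {K. subgroup K G}"
    by (simp add: card_image)
  have img: "h ` carrier G = carrier H"
  proof (intro equalityI subsetI)
    fix y assume "y \<in> carrier H"
    then show "y \<in> h ` carrier G" using hg[of y] by (intro image_eqI[of _ _ "g y"]) auto
  qed auto
  have "h ` generate G {x} = generate H {h x}" if "x \<in> carrier G" for x
    using h.generate_img[of "{x}"] that by simp
  then have "cyclic_subgroups H = (`) h ` cyclic_subgroups G"
    unfolding cyclic_subgroups_eq[OF assms(1)] cyclic_subgroups_eq[OF assms(2)] img[symmetric] image_image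
    by (auto intro!: image_cong)
  moreover have "inj_on ((`) h) (cyclic_subgroups G)"
    by (rule inj_on_subset[OF inj]) (auto simp: cyclic_subgroups_def dest: subgroup.subset)
  ultimately have 2: "card (cyclic_subgroups H) = card (cyclic_subgroups G)"
    by (simp add: card_image)
  show ?thesis by (simp add: cdeg_def 1 2)
qed

section \<open>Products of groups of coprime orders\<close>

lemma (in group) pow_cong_order:
  assumes "x \<in> carrier G" "[m = n] (mod order G)"
  shows "x [^] m = x [^] n"
proof -
  have "x [^] (order G * q + r) = x [^] r" for q r :: nat
    using assms(1) by (simp add: nat_pow_mult[symmetric] nat_pow_pow[symmetric] pow_order_eq_1)
  from this[of "k div order G" "k mod order G" for k]
  have "x [^] k = x [^] (k mod order G)" for k :: nat
    by (simp only: mult_div_mod_eq)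
  then show ?thesis using assms(2) by (metis cong_def)
qed

lemma pow_product_group:
  fixes n :: nat
  assumes "i \<in> I"
  shows "(f [^]\<^bsub>product_group I G\<^esub> n) i = f i [^]\<^bsub>G i\<^esub> n"
  by (induction n) (use assms in auto)

text \<open>For coprime orders the Chinese remainder theorem gives an exponent that
  keeps the \<open>i\<close>-th component of an element and kills all the others.\<close>

lemma subgroup_product_group_coprime:
  assumes "finite I" and gr: "\<And>i. i \<in> I \<Longrightarrow> group (G i)"
    and cop: "\<And>i j. \<lbrakk>i \<in> I; j \<in> I; i \<noteq> j\<rbrakk> \<Longrightarrow> coprime (order (G i)) (order (G j))"
    and S: "subgroup S (product_group I G)"
  shows "S = (\<Pi>\<^sub>E i\<in>I. (\<lambda>f. f i) ` S)"
proof
  interpret P: group "product_group I G" using gr by simp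
  interpret S: subgroup S "product_group I G" by fact
  have sub: "S \<subseteq> (\<Pi>\<^sub>E i\<in>I. carrier (G i))" using S.subset by simp
  show "S \<subseteq> (\<Pi>\<^sub>E i\<in>I. (\<lambda>f. f i) ` S)"
  proof
    fix f assume "f \<in> S"
    then show "f \<in> (\<Pi>\<^sub>E i\<in>I. (\<lambda>f. f i) ` S)"
      using sub by (auto simp: PiE_iff subset_iff intro: image_eqI[of _ _ f])
  qed
  show "(\<Pi>\<^sub>E i\<in>I. (\<lambda>f. f i) ` S) \<subseteq> S"
  proof
    fix g assume g: "g \<in> (\<Pi>\<^sub>E i\<in>I. (\<lambda>f. f i) ` S)"
    have gc: "g i \<in> carrier (G i)" if "i \<in> I" for i
    proof -
      have "g i \<in> (\<lambda>f. f i) ` S" using g that by (rule PiE_mem)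
      then obtain f where f: "f \<in> S" "g i = f i" by blast
      have "f i \<in> carrier (G i)" using subsetD[OF sub f(1)] that by (rule PiE_mem)
      then show ?thesis using f(2) by simp
    qed
    have single: "(\<lambda>j\<in>I. if j = i then g i else \<one>\<^bsub>G j\<^esub>) \<in> S" if i: "i \<in> I" for i
    proof -
      have "g i \<in> (\<lambda>f. f i) ` S" using g i by (rule PiE_mem)
      then obtain f where f: "f \<in> S" "f i = g i" by force
      have fc: "f j \<in> carrier (G j)" if "j \<in> I" for j
        using subsetD[OF sub f(1)] that by (rule PiE_mem)
      \<comment> \<open>\<open>N\<close> is a multiple of every order other than that of
        \<open>G i\<close>, and \<open>m\<close> inverts \<open>N\<close> modulo the order of
        \<open>G i\<close>. So \<open>N * m\<close> is 0 modulo the former and 1 modulo the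
        latter.\<close>
      define N where "N = (\<Prod>j\<in>I - {i}. order (G j))"
      have "coprime N (order (G i))"
        unfolding N_def using cop i by (intro prod_coprime_left) auto
      then obtain m where m: "[N * m = 1] (mod order (G i))"
        using cong_solve_coprime_nat by auto
      have "(f [^]\<^bsub>product_group I G\<^esub> (N * m)) j = (\<lambda>j\<in>I. if j = i then g i else \<one>\<^bsub>G j\<^esub>) j" for j
      proof (cases "j \<in> I")
        case j: True
        interpret Gj: group "G j" using gr j by simp
        show ?thesis
        proof (cases "j = i")
          case True
          have "f j [^]\<^bsub>G j\<^esub> (N * m) = f j [^]\<^bsub>G j\<^esub> (1::nat)"
            using Gj.pow_cong_order[OF fc[OF j]] m True by blast
          also have "\<dots> = f j" using fc[OF j] by simp
          finally show ?thesis using True j f(2) by (simp add: pow_product_group)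
        next
          case False
          then have "order (G j) dvd N"
            unfolding N_def using \<open>finite I\<close> j by (intro dvd_prodI) auto
          then have "[N * m = 0] (mod order (G j))"
            by (simp add: cong_0_iff)
          then show ?thesis
            using Gj.pow_cong_order[OF fc[OF j], of "N * m" 0] False j
            by (simp only: pow_product_group restrict_apply if_True if_False Gj.nat_pow_0)
        qed
      next
        case False
        \<comment> \<open>Elements of the product are extensional, so outside \<open>I\<close> both
          sides are \<open>undefined\<close>.\<close>
        have "f [^]\<^bsub>product_group I G\<^esub> (N * m) \<in> (\<Pi>\<^sub>E i\<in>I. carrier (G i))"
          using P.nat_pow_closed[of f "N * m"] f(1) S.mem_carrier by simp
        then show ?thesis using False by (auto simp: PiE_iff extensional_def)
      qed
      then have "f [^]\<^bsub>product_group I G\<^esub> (N * m) = (\<lambda>j\<in>I. if j = i then g i else \<one>\<^bsub>G j\<^esub>)" ..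
      moreover have "f [^]\<^bsub>product_group I G\<^esub> n \<in> S" for n :: nat
        by (induction n) (use f(1) S.m_closed S.one_closed in \<open>simp_all del: mult_product_group one_product_group\<close>)
      ultimately show ?thesis by metis
    qed
    \<comment> \<open>The one-component elements are multiplied together, one index at a time, until
      they make up \<open>g\<close>.\<close>
    have "(\<lambda>j\<in>I. if j \<in> J then g j else \<one>\<^bsub>G j\<^esub>) \<in> S" if "finite J" "J \<subseteq> I" for J
      using that
    proof (induction J rule: finite_induct)
      case empty
      then show ?case using S.one_closed by (simp add: restrict_def)
    next
      case (insert i J)
      have "(\<lambda>j\<in>I. if j \<in> insert i J then g j else \<one>\<^bsub>G j\<^esub>) =
        (\<lambda>j\<in>I. if j = i then g i else \<one>\<^bsub>G j\<^esub>) \<otimes>\<^bsub>product_group I G\<^esub> (\<lambda>j\<in>I. if j \<in> J then g j else \<one>\<^bsub>G j\<^esub>)"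
        using insert gc gr by (auto simp: fun_eq_iff group.is_monoid monoid.l_one monoid.r_one)
      also have "\<dots> \<in> S"
        using insert.prems by (intro S.m_closed single insert.IH) auto
      finally show ?case .
    qed
    from this[OF \<open>finite I\<close>] have "(\<lambda>j\<in>I. g j) \<in> S" 
      by (simp cong: restrict_cong)
    then show "g \<in> S" using g by (simp add: PiE_restrict)
  qed
qed

text \<open>Both counts factor, because \<open>PiE I\<close> maps families of subgroups bijectively
  to subgroups of the product, and families of cyclic ones to cyclic ones.\<close>

lemma cdeg_product_group_coprime:
  assumes fin: "finite I" and gr: "\<And>i. i \<in> I \<Longrightarrow> group (G i)"
    and cop: "\<And>i j. \<lbrakk>i \<in> I; j \<in> I; i \<noteq> j\<rbrakk> \<Longrightarrow> coprime (order (G i)) (order (G j))"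
  shows "cdeg (product_group I G) = (\<Prod>i\<in>I. cdeg (G i))"
proof -
  let ?P = "product_group I G"
  interpret P: group ?P using gr by simp
  have proj: "group_hom ?P (G i) (\<lambda>f. f i)" if "i \<in> I" for i
  proof -
    interpret group "G i" using gr that .
    show ?thesis by unfold_locales (use that in \<open>auto simp: hom_def\<close>)
  qed
  have S: "S = (\<Pi>\<^sub>E i\<in>I. (\<lambda>f. f i) ` S)" if "subgroup S ?P" for S
    using subgroup_product_group_coprime[OF fin gr cop that] .
  have sub: "{S. subgroup S ?P} = PiE I ` (\<Pi>\<^sub>E i\<in>I. {H. subgroup H (G i)})"
  proof (intro equalityI subsetI)
    fix S assume "S \<in> {S. subgroup S ?P}"
    then have sS: "subgroup S ?P" by simp
    have "S = PiE I (\<lambda>i\<in>I. (\<lambda>f. f i) ` S)"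
      using S[OF sS] by (simp cong: PiE_cong)
    moreover have "(\<lambda>i\<in>I. (\<lambda>f. f i) ` S) \<in> (\<Pi>\<^sub>E i\<in>I. {H. subgroup H (G i)})"
      using group_hom.subgroup_img_is_subgroup[OF proj sS] by auto
    ultimately show "S \<in> PiE I ` (\<Pi>\<^sub>E i\<in>I. {H. subgroup H (G i)})" by blast
  next
    fix S assume "S \<in> PiE I ` (\<Pi>\<^sub>E i\<in>I. {H. subgroup H (G i)})"
    then show "S \<in> {S. subgroup S ?P}"
      using PiE_subgroup_product_group[of I G] gr by (auto simp: PiE_iff)
  qed
  \<comment> \<open>A cyclic subgroup of the product is again the product of its projections, which
    are generated by the components of \<open>f\<close>. Read backwards, a product of cyclic groups
    of coprime orders is cyclic.\<close>
  have gen: "generate ?P {f} = PiE I (\<lambda>i\<in>I. generate (G i) {f i})" if f: "f \<in> carrier ?P" for f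
  proof -
    have "subgroup (generate ?P {f}) ?P" using f by (intro P.generate_is_subgroup) simp
    then have "generate ?P {f} = (\<Pi>\<^sub>E i\<in>I. (\<lambda>f. f i) ` generate ?P {f})" by (rule S)
    also have "\<dots> = (\<Pi>\<^sub>E i\<in>I. generate (G i) {f i})"
      using group_hom.generate_img[OF proj, of _ "{f}"] f by (intro PiE_cong) auto
    finally show ?thesis by (simp cong: PiE_cong)
  qed
  have cyc: "cyclic_subgroups ?P = PiE I ` (\<Pi>\<^sub>E i\<in>I. cyclic_subgroups (G i))"
  proof (intro equalityI subsetI)
    fix S assume "S \<in> cyclic_subgroups ?P"
    then obtain f where f: "f \<in> carrier ?P" "S = generate ?P {f}"
      by (auto simp: cyclic_subgroups_eq[OF P.is_group])
    then have "S = PiE I (\<lambda>i\<in>I. generate (G i) {f i})" using gen by simp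
    moreover have "(\<lambda>i\<in>I. generate (G i) {f i}) \<in> (\<Pi>\<^sub>E i\<in>I. cyclic_subgroups (G i))"
      using f(1) by (auto simp: cyclic_subgroups_eq[OF gr] intro!: imageI)
    ultimately show "S \<in> PiE I ` (\<Pi>\<^sub>E i\<in>I. cyclic_subgroups (G i))" by blast
  next
    fix S assume "S \<in> PiE I ` (\<Pi>\<^sub>E i\<in>I. cyclic_subgroups (G i))"
    then obtain H where H: "H \<in> (\<Pi>\<^sub>E i\<in>I. cyclic_subgroups (G i))" "S = PiE I H" by auto
    then have "\<forall>i\<in>I. \<exists>x. x \<in> carrier (G i) \<and> H i = generate (G i) {x}"
      using cyclic_subgroups_eq[OF gr] by (fastforce simp: PiE_iff)
    then obtain f where f: "\<And>i. i \<in> I \<Longrightarrow> f i \<in> carrier (G i) \<and> H i = generate (G i) {f i}"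
      by metis
    then have "S = generate ?P {\<lambda>i\<in>I. f i}" "(\<lambda>i\<in>I. f i) \<in> carrier ?P"
      using gen[of "\<lambda>i\<in>I. f i"] H(2) by (auto cong: PiE_cong)
    then show "S \<in> cyclic_subgroups ?P" by (auto simp: cyclic_subgroups_eq[OF P.is_group])
  qed
  \<comment> \<open>A product of nonempty sets determines its factors, and subgroups contain the
    identity.\<close>
  have inj: "inj_on (PiE I) (\<Pi>\<^sub>E i\<in>I. {H. subgroup H (G i)})"
  proof (rule inj_onI)
    fix A B assume AB: "A \<in> (\<Pi>\<^sub>E i\<in>I. {H. subgroup H (G i)})" "B \<in> (\<Pi>\<^sub>E i\<in>I. {H. subgroup H (G i)})"
      "PiE I A = PiE I B"
    then have "A i \<noteq> {}" if "i \<in> I" for i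
      using that subgroup.one_closed by (fastforce simp: PiE_iff)
    then have "\<forall>i\<in>I. A i = B i" using AB(3) by (auto simp: PiE_eq_iff)
    then show "A = B" using AB(1,2) by (auto intro: PiE_ext)
  qed
  have "cyclic_subgroups (G i) \<subseteq> {H. subgroup H (G i)}" for i
    by (auto simp: cyclic_subgroups_def)
  then have "(\<Pi>\<^sub>E i\<in>I. cyclic_subgroups (G i)) \<subseteq> (\<Pi>\<^sub>E i\<in>I. {H. subgroup H (G i)})"
    by (intro PiE_mono) auto
  then have "inj_on (PiE I) (\<Pi>\<^sub>E i\<in>I. cyclic_subgroups (G i))"
    by (rule inj_on_subset[OF inj])
  then show ?thesis
    unfolding cdeg_def sub cyc
    by (simp add: card_image[OF inj] card_image card_PiE[OF fin] prod_dividef)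
qed

section \<open>Counting subgroups in groups of order \<open>p ^ 3\<close>\<close>

text \<open>The elements of order \<open>d\<close> are partitioned by the cyclic subgroup that they
  generate, and a cyclic group of order \<open>d\<close> has \<open>totient d\<close>
  generators.\<close>

lemma card_elements_of_ord:
  fixes G (structure)
  assumes "group G" and fin: "finite (carrier G)"
  shows "card {x \<in> carrier G. group.ord G x = d} = card {H \<in> cyclic_subgroups G. card H = d} * totient d"
proof -
  interpret group G by fact
  let ?C = "{H \<in> cyclic_subgroups G. card H = d}"
  let ?E = "\<lambda>H. {x \<in> H. ord x = d}"
  have cyc: "subgroup H G" if "H \<in> ?C" for H using that by (simp add: cyclic_subgroups_def)
  have finH: "finite H" if "subgroup H G" for H
    using fin that by (metis finite_subset subgroup.subset)
  \<comment> \<open>An element of order \<open>d\<close> in a subgroup with \<open>d\<close>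
    elements generates it; hence the sets \<open>?E H\<close> are disjoint.\<close>
  have gen: "H = generate G {x}" if "H \<in> ?C" "x \<in> ?E H" for H x
  proof -
    have "generate G {x} \<subseteq> H"
      using that cyc by (intro generate_subgroup_incl) auto
    moreover have "card (generate G {x}) = card H"
      using that generate_pow_card[of x] subgroup.mem_carrier[OF cyc[OF that(1)], of x] by simp
    ultimately show ?thesis
      using finH[OF cyc[OF that(1)]] by (metis card_subset_eq)
  qed
  have card_E: "card (?E H) = totient d" if H: "H \<in> ?C" for H
  proof -
    obtain a where a: "a \<in> carrier G" "H = generate G {a}" "ord a = d"
      using H generate_pow_card by (auto simp: cyclic_subgroups_eq[OF is_group])
    \<comment> \<open>With exponents running from 1 to \<open>d\<close>, those that give generators
      are exactly the totatives of \<open>d\<close>.\<close>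
    have "H = (\<lambda>k. a [^] k) ` {1..d}"
    proof -
      have "card ((\<lambda>k. a [^] k) ` {1..d}) = card H"
        using ord_inj'[OF a(1)] H a(3) by (simp add: card_image)
      moreover have "(\<lambda>k. a [^] k) ` {1..d} \<subseteq> H"
        using generate_pow_on_finite_carrier[OF fin a(1)] a(2) by auto
      ultimately show ?thesis using finH[OF cyc[OF H]] by (metis card_subset_eq)
    qed
    then have "?E H = (\<lambda>k. a [^] k) ` totatives d"
      using pow_ord_eq_ord_iff[OF fin a(1)] a(3) by (auto simp: totatives_def Suc_le_eq)
    moreover have "inj_on (\<lambda>k. a [^] k) (totatives d)"
      using ord_inj'[OF a(1)] a(3) by (rule_tac inj_on_subset) (auto simp: totatives_def)
    ultimately show ?thesis by (simp add: card_image totient_def)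
  qed
  have "{x \<in> carrier G. ord x = d} = (\<Union>H\<in>?C. ?E H)"
  proof (intro equalityI subsetI)
    fix x assume x: "x \<in> {x \<in> carrier G. ord x = d}"
    then have "generate G {x} \<in> ?C" "x \<in> ?E (generate G {x})"
      using generate_pow_card[of x] by (auto simp: cyclic_subgroups_eq[OF is_group] generate.incl)
    then show "x \<in> (\<Union>H\<in>?C. ?E H)" by blast
  next
    fix x assume "x \<in> (\<Union>H\<in>?C. ?E H)"
    then obtain H where "H \<in> ?C" "x \<in> ?E H" by blast
    then show "x \<in> {x \<in> carrier G. ord x = d}"
      using subgroup.mem_carrier[OF cyc] by simp
  qed
  also have "card \<dots> = (\<Sum>H\<in>?C. card (?E H))"
  proof (rule card_UN_disjoint)
    show "finite ?C"
      by (rule finite_subset[OF _ finite_subgroups[OF fin]]) (use cyc in auto)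
    show "\<forall>H\<in>?C. finite (?E H)" using finH cyc by auto
    show "\<forall>H\<in>?C. \<forall>K\<in>?C. H \<noteq> K \<longrightarrow> ?E H \<inter> ?E K = {}"
      using gen by blast
  qed
  also have "\<dots> = card ?C * totient d" using card_E by simp
  finally show ?thesis .
qed

text \<open>The hypotheses record all that the count needs: the exponent divides
  \<open>p\<^sup>2\<close>, and the solutions of \<open>x [^] p = \<one>\<close> form a subgroup of
  order \<open>p\<^sup>2\<close>. They fix the number of elements of each order, and thereby the
  number of cyclic subgroups.\<close>

lemma cdeg_order_p3:
  fixes G (structure)
  assumes "group G" and p: "prime p" and ord: "order G = p ^ 3"
    and exp: "\<And>x. x \<in> carrier G \<Longrightarrow> x [^] p\<^sup>2 = \<one>"
    and Om: "subgroup {x \<in> carrier G. x [^] p = \<one>} G" "card {x \<in> carrier G. x [^] p = \<one>} = p\<^sup>2"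
  shows "cdeg G = (real p + 1) / (real p + 2)"
proof -
  interpret group G by fact
  define W where "W = {x \<in> carrier G. x [^] p = \<one>}"
  have p1: "p > 1" using p prime_gt_1_nat by auto
  have pm1: "p - 1 \<noteq> 0" using p1 by simp
  have lt: "1 < p" "p < p\<^sup>2" "p\<^sup>2 < p ^ 3"
    using p1 by (auto simp: power2_eq_square power3_eq_cube)
  have fin: "finite (carrier G)"
    using ord p1 order_gt_0_iff_finite by simp
  have ord_cases: "ord x \<in> {1, p, p\<^sup>2}" if "x \<in> carrier G" for x
  proof -
    have "ord x dvd p\<^sup>2" using exp[OF that] pow_eq_id[OF that] by simp
    then obtain k where "k \<le> 2" "ord x = p ^ k"
      using divides_primepow_nat[OF p] by auto
    then show ?thesis by (auto simp: le_Suc_eq numeral_2_eq_2)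
  qed
  have W_ord: "x \<in> W \<longleftrightarrow> x \<in> carrier G \<and> ord x \<noteq> p\<^sup>2" for x
    proof -
    have "\<not> p\<^sup>2 dvd p" using lt by (auto dest: dvd_imp_le)
    then show ?thesis using ord_cases[of x] pow_eq_id[of x p] by (auto simp: W_def)
  qed
  have W: "subgroup W G" "card W = p\<^sup>2" using Om by (simp_all add: W_def)
  let ?C = "\<lambda>d. {H \<in> cyclic_subgroups G. card H = d}"
  let ?E = "\<lambda>d. {x \<in> carrier G. ord x = d}"
  have E1: "?E 1 = {\<one>}" by (auto simp: ord_eq_1[unfolded One_nat_def])
  have Ep2: "?E (p\<^sup>2) = carrier G - W" using W_ord by auto
  have Ep: "?E p = W - {\<one>}" using W_ord ord_cases E1 lt by fastforce
  have finW: "finite W" "W \<subseteq> carrier G" using W(1) subgroup.subset fin finite_subset by blast+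
  have C1: "card (?C 1) = 1"
    using card_elements_of_ord[OF is_group fin, of 1] E1 by simp
  \<comment> \<open>The elements of order \<open>p\<close> are those of \<open>W\<close> other than
    the identity, and each cyclic subgroup of order \<open>p\<close> accounts for
    \<open>p - 1\<close> of them.\<close>
  have "card (?C p) * (p - 1) = p\<^sup>2 - 1"
    using card_elements_of_ord[OF is_group fin, of p] W finW p subgroup.one_closed[OF W(1)]
    by (simp add: Ep totient_prime card_Diff_singleton)
  also have "\<dots> = (p + 1) * (p - 1)"
    using p1 by (simp add: power2_eq_square algebra_simps)
  finally have Cp: "card (?C p) = p + 1" using pm1 by (metis mult_right_cancel)
  \<comment> \<open>All elements outside \<open>W\<close> have order \<open>p\<^sup>2\<close>, and
    \<open>totient (p\<^sup>2)\<close> of them generate the same subgroup.\<close>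
  have "card (?C (p\<^sup>2)) * (p * (p - 1)) = p ^ 3 - p\<^sup>2"
    using card_elements_of_ord[OF is_group fin, of "p\<^sup>2"] W finW p ord totient_prime_power[OF p, of 2]
    by (simp add: Ep2 card_Diff_subset order_def)
  also have "\<dots> = p * (p * (p - 1))"
    by (simp add: power2_eq_square power3_eq_cube algebra_simps)
  finally have Cp2: "card (?C (p\<^sup>2)) = p" using pm1 p1 by (metis mult_right_cancel mult_eq_0_iff not_one_less_zero)
  have gen_card: "generate G {x} \<in> cyclic_subgroups G" "card (generate G {x}) = ord x"
    if "x \<in> carrier G" for x
    using that generate_pow_card by (auto simp: cyclic_subgroups_eq[OF is_group])
  have cyc_card: "card H \<in> {1, p, p\<^sup>2}" if H: "H \<in> cyclic_subgroups G" for H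
  proof -
    obtain x where x: "x \<in> carrier G" "H = generate G {x}"
      using H by (auto simp: cyclic_subgroups_eq[OF is_group])
    show ?thesis using ord_cases[OF x(1)] unfolding x(2) gen_card(2)[OF x(1)] .
  qed
  have finC: "finite (cyclic_subgroups G)"
    using fin by (simp add: cyclic_subgroups_eq[OF is_group])
  have "cyclic_subgroups G = ?C 1 \<union> (?C p \<union> ?C (p\<^sup>2))" using cyc_card by blast
  then have "card (cyclic_subgroups G) = card (?C 1 \<union> (?C p \<union> ?C (p\<^sup>2)))" by (rule arg_cong)
  also have "\<dots> = card (?C 1) + card (?C p \<union> ?C (p\<^sup>2))"
    using finC lt by (intro card_Un_disjoint) auto
  also have "card (?C p \<union> ?C (p\<^sup>2)) = card (?C p) + card (?C (p\<^sup>2))"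
    using finC lt by (intro card_Un_disjoint) auto
  finally have cyc: "card (cyclic_subgroups G) = 2 * p + 2" using C1 Cp Cp2 by simp
  \<comment> \<open>A generator of \<open>W\<close> would have order \<open>p\<^sup>2\<close>, but
    such elements lie outside \<open>W\<close>.\<close>
  have W_nc: "W \<notin> cyclic_subgroups G"
  proof
    assume "W \<in> cyclic_subgroups G"
    then obtain x where x: "x \<in> carrier G" "W = generate G {x}" by (auto simp: cyclic_subgroups_eq[OF is_group])
    then have "ord x = p\<^sup>2" "x \<in> W" using W(2) gen_card generate.incl[of x "{x}" G] by auto
    then show False using W_ord by blast
  qed
  have G_nc: "carrier G \<notin> cyclic_subgroups G"
  proof
    assume "carrier G \<in> cyclic_subgroups G"
    then have "p ^ 3 \<in> {1, p, p\<^sup>2}" using cyc_card ord unfolding order_def by metis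
    then show False using lt by auto
  qed
  have "H \<in> cyclic_subgroups G \<union> {W, carrier G}" if H: "subgroup H G" for H
  proof -
    have HG: "H \<subseteq> carrier G" "finite H" using subgroup.subset[OF H] fin finite_subset by blast+
    have gen_le: "generate G {x} \<subseteq> H" if "x \<in> H" for x
      using that H by (intro generate_subgroup_incl) auto
    have gen_eq: "H \<in> cyclic_subgroups G" if "x \<in> H" "card H = ord x" for x
    proof -
      have "generate G {x} = H"
        using gen_le[OF that(1)] gen_card[of x] that HG by (intro card_subset_eq) auto
      then show ?thesis using gen_card[of x] that HG by auto
    qed
    have "card H dvd p ^ 3"
      using lagrange[OF H] ord by (metis dvd_triv_right)
    then obtain k where k: "k \<le> 3" "card H = p ^ k"
      using divides_primepow_nat[OF p] by auto
    show ?thesis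
    \<comment> \<open>Inside \<open>W\<close>, the order of \<open>H\<close> is 1 or
      \<open>p\<close>, which makes \<open>H\<close> cyclic, or \<open>p\<^sup>2\<close>, which
      forces \<open>H = W\<close>. Otherwise \<open>H\<close> has an element of order
      \<open>p\<^sup>2\<close>; it either generates \<open>H\<close>, or \<open>H\<close> is the
      whole group.\<close>
    proof (cases "H \<subseteq> W")
      case True
      then have "p ^ k \<le> p\<^sup>2" using card_mono[OF finW(1) True] k W(2) by simp
      then have "k \<le> 2" using p1 by simp
      then consider "k = 0" | "k = 1" | "k = 2" by linarith
      then show ?thesis
      proof cases
        case 1
        then show ?thesis using gen_eq[of \<one>] k subgroup.one_closed[OF H] by simp
      next
        case 2
        then have "H \<noteq> {\<one>}" using k p1 by auto
        then obtain x where x: "x \<in> H" "x \<noteq> \<one>" using subgroup.one_closed[OF H] by blast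
        then have "ord x = p" using True Ep by blast
        then show ?thesis using gen_eq[of x] x k 2 by simp
      next
        case 3
        then have "H = W" using True k W finW by (intro card_subset_eq) auto
        then show ?thesis by simp
      qed
    next
      case False
      then obtain x where x: "x \<in> H" "ord x = p\<^sup>2" using HG W_ord by blast
      have "p\<^sup>2 \<le> p ^ k"
        using card_mono[OF HG(2) gen_le[OF x(1)]] gen_card[of x] x HG k by auto
      then have "k \<ge> 2" using p1 by simp
      then consider "k = 2" | "k = 3" using k by linarith
      then show ?thesis
      proof cases
        case 1
        then show ?thesis using gen_eq[OF x(1)] x k by simp
      next
        case 2
        then have "H = carrier G" using HG k fin ord by (intro card_subset_eq) (auto simp: order_def)
        then show ?thesis by simp
      qed
    qed
  qed
  then have "{H. subgroup H G} = insert W (insert (carrier G) (cyclic_subgroups G))"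
    using W(1) subgroup_self by (auto simp: cyclic_subgroups_def)
  moreover have "W \<noteq> carrier G" using W(2) ord lt by (auto simp: order_def)
  ultimately have "card {H. subgroup H G} = 2 * p + 4"
    using finC W_nc G_nc cyc by simp
  then show ?thesis by (simp add: cdeg_def cyc divide_simps) (simp add: algebra_simps)
qed

section \<open>The modular group of order \<open>p\<^sup>3\<close>\<close>

text \<open>The homomorphism from the free group that extends \<open>f\<close>, read off on words
  that need not be reduced.\<close>

definition eval_word :: "('a, 'b) monoid_scheme \<Rightarrow> ('g \<Rightarrow> 'a) \<Rightarrow> 'g word \<Rightarrow> 'a" where
  "eval_word G f u = foldr (\<lambda>(g, b) x. (if b then f g else inv\<^bsub>G\<^esub> f g) \<otimes>\<^bsub>G\<^esub> x) u \<one>\<^bsub>G\<^esub>"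

lemma eval_word_Nil [simp]: "eval_word G f [] = \<one>\<^bsub>G\<^esub>"
  by (simp add: eval_word_def)

lemma eval_word_Cons [simp]:
  "eval_word G f ((g, b) # u) = (if b then f g else inv\<^bsub>G\<^esub> f g) \<otimes>\<^bsub>G\<^esub> eval_word G f u"
  by (simp add: eval_word_def)

context group
begin

lemma eval_word_closed [simp]: "range f \<subseteq> carrier G \<Longrightarrow> eval_word G f u \<in> carrier G"
  by (induction u) (auto simp: image_subset_iff)

lemma eval_word_append:
  "range f \<subseteq> carrier G \<Longrightarrow> eval_word G f (u @ v) = eval_word G f u \<otimes> eval_word G f v"
proof (induction u)
  case (Cons a u)
  then show ?case by (cases a) (auto simp: m_assoc image_subset_iff)
qed simp

lemma eval_word_replicate:
  "range f \<subseteq> carrier G \<Longrightarrow> eval_word G f (replicate n (g, True)) = f g [^] n"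
  by (induction n) (auto simp: nat_pow_Suc2[symmetric] image_subset_iff)

text \<open>Equality of values in a group obeys every rule that generates \<open>word_eq\<close>, so
  evaluation descends to the presented group once the relations hold in \<open>G\<close>.\<close>

lemma eval_word_cong:
  assumes "range f \<subseteq> carrier G" "\<And>u v. (u, v) \<in> R \<Longrightarrow> eval_word G f u = eval_word G f v"
    and "word_eq R u v"
  shows "eval_word G f u = eval_word G f v"
  using assms(3)
proof induction
  case (cancel g b)
  have "f g \<in> carrier G" using assms(1) by auto
  then show ?case by (cases b) auto
qed (use assms in \<open>auto simp: eval_word_append\<close>)

end

abbreviation word_class :: "('g word \<times> 'g word) set \<Rightarrow> 'g word \<Rightarrow> 'g word set" where
  "word_class R u \<equiv> {w. word_eq R u w}"

lemma word_class_eq_iff: "word_class R u = word_class R v \<longleftrightarrow> word_eq R u v"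
  by (auto intro: word_eq.refl word_eq.sym word_eq.trans)

lemma presented_group_one: "\<one>\<^bsub>presented_group R\<^esub> = word_class R []"
  by (simp add: presented_group_def)

lemma word_class_closed: "word_class R u \<in> carrier (presented_group R)"
  by (simp add: presented_group_carrier)

text \<open>Transfers facts on \<open>eval_word\<close> in an arbitrary group, such as the normal
  form below, to the elements of the presented group itself.\<close>

lemma word_class_eq_eval_word:
  "word_class R u = eval_word (presented_group R) (\<lambda>g. word_class R [(g, True)]) u"
proof (induction u)
  case Nil
  then show ?case by (simp add: presented_group_one)
next
  case (Cons a u)
  interpret group "presented_group R" by (rule group_presented_group)
  obtain g b where a: "a = (g, b)" by (cases a)
  have "word_class R [(g, False)] \<otimes>\<^bsub>presented_group R\<^esub> word_class R [(g, True)] = \<one>\<^bsub>presented_group R\<^esub>"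
    using word_eq.cancel[of R g False] by (simp add: presented_group_mult presented_group_one word_class_eq_iff)
  then have inv: "inv\<^bsub>presented_group R\<^esub> word_class R [(g, True)] = word_class R [(g, False)]"
    by (intro inv_equality word_class_closed)
  have 1: "word_class R (a # u) = word_class R [a] \<otimes>\<^bsub>presented_group R\<^esub> word_class R u"
    by (simp add: presented_group_mult)
  have 2: "word_class R [a] =
      (if b then word_class R [(g, True)] else inv\<^bsub>presented_group R\<^esub> word_class R [(g, True)])"
    by (cases b) (simp_all only: a inv if_True if_False)
  show ?case
    unfolding 1 unfolding 2 unfolding a eval_word_Cons by (rule arg_cong[OF Cons.IH])
qed

text \<open>Von Dyck's theorem: an assignment of generators that respects the relations extends to a
  homomorphism.\<close>

lemma presented_group_hom_exists:
  assumes "group K" "range f \<subseteq> carrier K"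
    and "\<And>u v. (u, v) \<in> R \<Longrightarrow> eval_word K f u = eval_word K f v"
  obtains h where "h \<in> hom (presented_group R) K" "\<And>u. h (word_class R u) = eval_word K f u"
proof
  interpret group K by fact
  \<comment> \<open>Evaluation is constant on each class, so its image is a singleton and
    \<open>the_elem\<close> returns the common value.\<close>
  define h where "h A = the_elem (eval_word K f ` A)" for A
  show h: "h (word_class R u) = eval_word K f u" for u
  proof -
    have "eval_word K f ` word_class R u = {eval_word K f u}"
    proof (intro equalityI subsetI)
      fix x assume "x \<in> eval_word K f ` word_class R u"
      then obtain w where "x = eval_word K f w" "word_eq R u w" by blast
      then show "x \<in> {eval_word K f u}"
        using eval_word_cong[OF assms(2,3), of R u w] by simp
    qed (simp add: word_eq.refl)
    then show ?thesis by (simp add: h_def)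
  qed
  show "h \<in> hom (presented_group R) K"
    by (auto simp: hom_def presented_group_carrier presented_group_mult h eval_word_append assms(2))
qed

section \<open>A concrete model on pairs of exponents\<close>

text \<open>The pair \<open>(b, a)\<close> stands for the normal form \<open>y\<^sup>b x\<^sup>a\<close>; the multiplication comes from
  \<open>x\<^sup>a y\<^sup>d = y\<^sup>d x\<^bsup>a (p + 1)^d\<^esup>\<close> and \<open>(p + 1)^d \<equiv> 1 + p d\<close> modulo \<open>p\<^sup>2\<close>.\<close>

definition modular_pairs :: "nat \<Rightarrow> (nat \<times> nat) monoid" where
  "modular_pairs p =
     \<lparr>carrier = {..<p} \<times> {..<p\<^sup>2},
      monoid.mult = (\<lambda>(b, a) (d, c). ((b + d) mod p, (a + c + p * a * d) mod p\<^sup>2)),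
      one = (0, 0)\<rparr>"

lemma modular_pairs_carrier [simp]: "carrier (modular_pairs p) = {..<p} \<times> {..<p\<^sup>2}"
  and modular_pairs_one [simp]: "\<one>\<^bsub>modular_pairs p\<^esub> = (0, 0)"
  and modular_pairs_mult [simp]:
    "(b, a) \<otimes>\<^bsub>modular_pairs p\<^esub> (d, c) = ((b + d) mod p, (a + c + p * a * d) mod p\<^sup>2)"
  by (simp_all add: modular_pairs_def)

text \<open>The factor \<open>p\<close> in front makes the twist depend on the exponent of
  \<open>y\<close> modulo \<open>p\<close> only. Reducing that exponent is therefore harmless, as
  associativity requires.\<close>

lemma mult_mod_square: "(p * a * (d mod p)) mod p\<^sup>2 = (p * a * d) mod (p\<^sup>2 :: nat)"
proof -
  have "p * (a * (d mod p)) mod (p * p) = p * (a * d) mod (p * p)"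
    by (simp add: mult_mod_right[symmetric] mod_mult_right_eq)
  then show ?thesis by (simp add: power2_eq_square mult.assoc)
qed

lemma group_modular_pairs:
  assumes "p > 1"
  shows "group (modular_pairs p)"
proof (rule groupI)
  let ?M = "modular_pairs p"
  show "x \<otimes>\<^bsub>?M\<^esub> y \<in> carrier ?M" if "x \<in> carrier ?M" "y \<in> carrier ?M" for x y
    using that assms by (cases x; cases y) auto
  show "x \<otimes>\<^bsub>?M\<^esub> y \<otimes>\<^bsub>?M\<^esub> z = x \<otimes>\<^bsub>?M\<^esub> (y \<otimes>\<^bsub>?M\<^esub> z)" for x y z
  proof -
    obtain b a d c f e where xyz: "x = (b, a)" "y = (d, c)" "z = (f, e)"
      by (metis surj_pair)
    have "[(a + c + p * a * d) mod p\<^sup>2 + e + p * ((a + c + p * a * d) mod p\<^sup>2) * f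
      = (a + c + p * a * d) + e + p * (a + c + p * a * d) * f] (mod p\<^sup>2)"
      by (intro cong_add cong_mult cong_refl) auto
    \<comment> \<open>The two bracketings differ only by the term with
      \<open>p\<^sup>2\<close>.\<close>
    also have "(a + c + p * a * d) + e + p * (a + c + p * a * d) * f
      = a + (c + e + p * c * f) + p * a * (d + f) + p\<^sup>2 * (a * d * f)"
      by (simp add: algebra_simps power2_eq_square)
    also have "[\<dots> = a + (c + e + p * c * f) + p * a * (d + f)] (mod p\<^sup>2)"
      by (simp add: cong_def)
    also have "[a + (c + e + p * c * f) + p * a * (d + f)
      = a + (c + e + p * c * f) mod p\<^sup>2 + p * a * ((d + f) mod p)] (mod p\<^sup>2)"
      by (intro cong_add cong_refl) (auto simp: cong_def mult_mod_square)
    finally show ?thesis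
      by (simp add: xyz cong_def mod_simps add.assoc)
  qed
  show "\<one>\<^bsub>?M\<^esub> \<otimes>\<^bsub>?M\<^esub> x = x" if "x \<in> carrier ?M" for x
    using that by (cases x) auto
  show "\<exists>y\<in>carrier ?M. y \<otimes>\<^bsub>?M\<^esub> x = \<one>\<^bsub>?M\<^esub>" if x: "x \<in> carrier ?M" for x
  proof -
    obtain b a where ba: "x = (b, a)" "b < p" "a < p\<^sup>2" using x by (cases x) auto
    \<comment> \<open>Solves \<open>c * (1 + p * b) + a = 0\<close> modulo \<open>p\<^sup>2\<close>,
      where \<open>1 + p * b\<close> has the inverse \<open>1 - p * b\<close>. The summand
      \<open>p\<^sup>2\<close> keeps the subtraction within the naturals.\<close>
    define c where "c = p\<^sup>2 - a + p * a * b"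
    have "[c mod p\<^sup>2 + a + p * (c mod p\<^sup>2) * b = c + a + p * c * b] (mod p\<^sup>2)"
      by (intro cong_add cong_mult cong_refl) auto
    also have "c + a + p * c * b = p\<^sup>2 * (1 + p * b + a * b * b)"
    proof -
      have "c + a = p\<^sup>2 + p * a * b" using ba by (simp add: c_def)
      moreover have "p * c * b + p * a * b = p * b * (c + a)" by (simp add: algebra_simps)
      ultimately show ?thesis by (simp add: algebra_simps power2_eq_square)
    qed
    also have "[\<dots> = 0] (mod p\<^sup>2)" by (simp add: cong_0_iff)
    finally have "(c mod p\<^sup>2 + a + p * (c mod p\<^sup>2) * b) mod p\<^sup>2 = 0" by (simp add: cong_def)
    moreover have "((p - b) mod p + b) mod p = 0" using ba by (simp add: mod_simps)
    ultimately show ?thesis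
      using ba assms by (intro bexI[of _ "((p - b) mod p, c mod p\<^sup>2)"]) (simp_all add: ba)
  qed
qed (use assms in auto)

text \<open>Appending a factor to the \<open>n\<close>-th power contributes a twist of
  \<open>p * (n * a) * b\<close> modulo \<open>p\<^sup>2\<close>; summing over the earlier exponents
  gives the binomial coefficient.\<close>

lemma modular_pairs_pow:
  fixes n :: nat
  shows "(b, a) [^]\<^bsub>modular_pairs p\<^esub> n = ((n * b) mod p, (n * a + p * a * b * (n choose 2)) mod p\<^sup>2)"
proof (induction n)
  case 0
  then show ?case by (simp add: nat_pow_def binomial_eq_0)
next
  case (Suc n)
  let ?k = "n * a + p * a * b * (n choose 2)"
  have "[?k mod p\<^sup>2 + a + p * (?k mod p\<^sup>2) * b = ?k + a + p * ?k * b] (mod p\<^sup>2)"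
    by (intro cong_add cong_mult cong_refl) auto
  also have "?k + a + p * ?k * b =
    Suc n * a + p * a * b * (Suc n choose 2) + p\<^sup>2 * (a * b * b * (n choose 2))"
    by (simp add: algebra_simps power2_eq_square numeral_2_eq_2)
  also have "[\<dots> = Suc n * a + p * a * b * (Suc n choose 2)] (mod p\<^sup>2)"
    by (simp add: cong_def)
  finally show ?case
    by (simp add: Suc.IH nat_pow_Suc cong_def mod_simps add.commute)
qed

text \<open>Oddness of \<open>p\<close> enters here: \<open>p\<close> then divides
  \<open>p choose 2\<close>, so the twist vanishes modulo \<open>p\<^sup>2\<close>.\<close>

lemma modular_pairs_pow_p:
  assumes "odd p" "p > 1"
  shows "(b, a) [^]\<^bsub>modular_pairs p\<^esub> p = (0, (p * a) mod p\<^sup>2)"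
proof -
  have "p choose 2 = p * ((p - 1) div 2)"
    using assms by (simp add: choose_two div_mult_swap)
  then have eq: "p * a + p * a * b * (p choose 2) = p * a + p\<^sup>2 * (a * b * ((p - 1) div 2))"
    by (simp add: power2_eq_square algebra_simps)
  show ?thesis unfolding modular_pairs_pow eq by simp
qed

lemma cdeg_modular_pairs:
  assumes "prime p" "odd p"
  shows "cdeg (modular_pairs p) = (real p + 1) / (real p + 2)"
proof -
  have p1: "p > 1" using assms prime_gt_1_nat by auto
  let ?M = "modular_pairs p"
  interpret group ?M using group_modular_pairs[OF p1] .
  have pow_p: "(b, a) [^]\<^bsub>?M\<^esub> p = (0, (p * a) mod p\<^sup>2)" for a b
    using modular_pairs_pow_p[OF assms(2) p1] .
  \<comment> \<open>The \<open>p\<close>-th power is trivial exactly when \<open>p\<^sup>2\<close>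
    divides \<open>p * a\<close>, that is, when \<open>p\<close> divides \<open>a\<close>. This
    leaves \<open>p\<close> choices for each coordinate.\<close>
  have W: "{x \<in> carrier ?M. x [^]\<^bsub>?M\<^esub> p = \<one>\<^bsub>?M\<^esub>} = {..<p} \<times> (*) p ` {..<p}" (is "?W = _")
  proof (intro equalityI subsetI)
    fix x assume "x \<in> ?W"
    then obtain b a where ba: "x = (b, a)" "b < p" "a < p\<^sup>2" "p\<^sup>2 dvd p * a"
      by (cases x) (auto simp: pow_p)
    then obtain k where "a = p * k" using p1 by (auto simp: power2_eq_square)
    then show "x \<in> {..<p} \<times> (*) p ` {..<p}" using ba by (auto simp: power2_eq_square)
  next
    fix x assume "x \<in> {..<p} \<times> (*) p ` {..<p}"
    then show "x \<in> ?W" by (auto simp: pow_p power2_eq_square)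
  qed
  show ?thesis
  proof (rule cdeg_order_p3[OF is_group assms(1)])
    show "order ?M = p ^ 3"
      by (simp add: order_def power2_eq_square power3_eq_cube)
    show "x [^]\<^bsub>?M\<^esub> p\<^sup>2 = \<one>\<^bsub>?M\<^esub>" if "x \<in> carrier ?M" for x
    proof -
      obtain b a where "x = (b, a)" by (cases x)
      moreover have "x [^]\<^bsub>?M\<^esub> p\<^sup>2 = (x [^]\<^bsub>?M\<^esub> p) [^]\<^bsub>?M\<^esub> p"
        using that by (simp add: nat_pow_pow power2_eq_square)
      moreover have "p * (p * a mod p\<^sup>2) mod p\<^sup>2 = 0"
        by (simp add: mod_simps) (simp add: power2_eq_square)
      ultimately show ?thesis by (simp add: pow_p)
    qed
    show "subgroup ?W ?M"
    proof (rule subgroupI)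
      show "inv\<^bsub>?M\<^esub> x \<in> ?W" if "x \<in> ?W" for x
        using that nat_pow_inv[of x p] by (simp del: modular_pairs_carrier modular_pairs_one)
      show "x \<otimes>\<^bsub>?M\<^esub> y \<in> ?W" if xy: "x \<in> ?W" "y \<in> ?W" for x y
      proof -
        obtain b i d j where xy: "x = (b, p * i)" "y = (d, p * j)"
          using xy unfolding W by auto
        have "x \<otimes>\<^bsub>?M\<^esub> y \<in> carrier ?M" using that by (intro m_closed) auto
        \<comment> \<open>Every summand of the second coordinate carries a factor \<open>p\<close>;
          one more gives 0 modulo \<open>p\<^sup>2\<close>.\<close>
        moreover have "p * ((p * i + p * j + p * (p * i) * d) mod p\<^sup>2) mod p\<^sup>2 = 0"
          by (simp add: mod_simps) (simp add: power2_eq_square algebra_simps)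
        ultimately show ?thesis by (simp add: xy pow_p)
      qed
      show "?W \<noteq> {}" unfolding W using p1 by (auto simp: lessThan_empty_iff)
    qed auto
    show "card ?W = p\<^sup>2"
      unfolding W using p1 by (simp add: card_cartesian_product card_image inj_on_def power2_eq_square)
  qed
qed

section \<open>Normal forms and the isomorphism with the model\<close>

text \<open>Moving every \<open>y\<close> to the left turns a word into a product \<open>y\<^sup>b x\<^sup>a\<close>.\<close>

lemma (in group) eval_word_modular_normal_form:
  fixes p :: nat
  assumes f: "range f \<subseteq> carrier G" and "p > 0"
    and x: "f Gen_x [^] p\<^sup>2 = \<one>" and y: "f Gen_y [^] p = \<one>"
    and xy: "inv (f Gen_y) \<otimes> f Gen_x \<otimes> f Gen_y = f Gen_x [^] (p + 1)"
  obtains b a where "b < p" "a < p\<^sup>2" "eval_word G f u = f Gen_y [^] b \<otimes> f Gen_x [^] a"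
proof -
  define X Y where "X = f Gen_x" and "Y = f Gen_y"
  have XY [simp]: "X \<in> carrier G" "Y \<in> carrier G" using f by (auto simp: X_def Y_def)
  have Xp: "X [^] p\<^sup>2 = \<one>" and Yp: "Y [^] p = \<one>" using x y by (simp_all add: X_def Y_def)
  have "X \<otimes> Y = Y \<otimes> (inv Y \<otimes> X \<otimes> Y)" by (simp add: m_assoc[symmetric])
  also have "inv Y \<otimes> X \<otimes> Y = X [^] (p + 1)" using xy by (simp add: X_def Y_def)
  finally have comm: "X \<otimes> Y = Y \<otimes> X [^] (p + 1)" .
  have comm': "X [^] n \<otimes> Y = Y \<otimes> X [^] ((p + 1) * n)" for n :: nat
  proof (induction n)
    case (Suc n)
    have "X [^] Suc n \<otimes> Y = X [^] n \<otimes> (X \<otimes> Y)" by (simp add: m_assoc)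
    also have "\<dots> = X [^] n \<otimes> Y \<otimes> X [^] (p + 1)" by (simp only: comm) (simp add: m_assoc)
    also have "\<dots> = Y \<otimes> (X [^] ((p + 1) * n) \<otimes> X [^] (p + 1))" by (simp only: Suc.IH) (simp add: m_assoc)
    also have "\<dots> = Y \<otimes> X [^] ((p + 1) * Suc n)" by (simp only: nat_pow_mult XY) (simp add: algebra_simps)
    finally show ?case .
  qed simp
  \<comment> \<open>Exponents stay unbounded here and are reduced only at the end. As words are
    evaluated by multiplying letters on the left, closure of \<open>S\<close> under left
    multiplication suffices.\<close>
  define S where "S = {Y [^] b \<otimes> X [^] a | (b :: nat) (a :: nat). True}"
  have SY: "Y [^] n \<otimes> s \<in> S" if "s \<in> S" for s and n :: nat
  proof -
    obtain b a :: nat where "s = Y [^] b \<otimes> X [^] a" using \<open>s \<in> S\<close> by (auto simp: S_def)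
    then have "Y [^] n \<otimes> s = Y [^] (n + b) \<otimes> X [^] a"
      by (simp add: m_assoc[symmetric] nat_pow_mult)
    then show ?thesis unfolding S_def by blast
  qed
  have SX: "\<exists>c::nat. X [^] n \<otimes> Y [^] b = Y [^] b \<otimes> X [^] c" for n b :: nat
  proof (induction b)
    case 0
    then show ?case by (auto intro: exI[of _ n])
  next
    case (Suc b)
    then obtain c :: nat where c: "X [^] n \<otimes> Y [^] b = Y [^] b \<otimes> X [^] c" by blast
    have "X [^] n \<otimes> Y [^] Suc b = X [^] n \<otimes> Y [^] b \<otimes> Y" by (simp add: m_assoc)
    also have "\<dots> = Y [^] b \<otimes> (X [^] c \<otimes> Y)" by (simp only: c) (simp add: m_assoc)
    also have "\<dots> = Y [^] Suc b \<otimes> X [^] ((p + 1) * c)" by (simp only: comm') (simp add: m_assoc)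
    finally show ?case by blast
  qed
  have SX: "X [^] n \<otimes> s \<in> S" if s: "s \<in> S" for s and n :: nat
  proof -
    obtain b a :: nat where s: "s = Y [^] b \<otimes> X [^] a" using s by (auto simp: S_def)
    obtain c :: nat where c: "X [^] n \<otimes> Y [^] b = Y [^] b \<otimes> X [^] c" using SX by blast
    have "X [^] n \<otimes> s = X [^] n \<otimes> Y [^] b \<otimes> X [^] a" by (simp add: s m_assoc)
    also have "\<dots> = Y [^] b \<otimes> X [^] (c + a)" by (simp only: c) (simp add: m_assoc nat_pow_mult)
    finally show ?thesis unfolding S_def by blast
  qed
  \<comment> \<open>Finite order turns inverse letters into positive powers, which the closure
    properties of \<open>S\<close> cover.\<close>
  have invX: "inv X = X [^] (p\<^sup>2 - 1)"
  proof (rule inv_equality)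
    have "X [^] (p\<^sup>2 - 1) \<otimes> X = X [^] (Suc (p\<^sup>2 - 1))" by simp
    also have "Suc (p\<^sup>2 - 1) = p\<^sup>2" using \<open>p > 0\<close> by simp
    finally show "X [^] (p\<^sup>2 - 1) \<otimes> X = \<one>" using Xp by simp
  qed auto
  have invY: "inv Y = Y [^] (p - 1)"
  proof (rule inv_equality)
    have "Y [^] (p - 1) \<otimes> Y = Y [^] (Suc (p - 1))" by simp
    also have "Suc (p - 1) = p" using \<open>p > 0\<close> by simp
    finally show "Y [^] (p - 1) \<otimes> Y = \<one>" using Yp by simp
  qed auto
  have "eval_word G f u \<in> S"
  proof (induction u)
    case Nil
    have "\<one> = Y [^] (0::nat) \<otimes> X [^] (0::nat)" by simp
    then show ?case unfolding S_def eval_word_Nil by blast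
  next
    case (Cons l u)
    obtain g s where l: "l = (g, s)" by (cases l)
    have "X \<otimes> eval_word G f u \<in> S" "Y \<otimes> eval_word G f u \<in> S"
      using SX[OF Cons, of 1] SY[OF Cons, of 1] by simp_all
    moreover have "inv X \<otimes> eval_word G f u \<in> S" "inv Y \<otimes> eval_word G f u \<in> S"
      using SX[OF Cons] SY[OF Cons] by (simp_all add: invX invY)
    ultimately show ?case
      by (cases g; cases s) (simp_all add: l X_def Y_def)
  qed
  then obtain b a :: nat where ba: "eval_word G f u = Y [^] b \<otimes> X [^] a" by (auto simp: S_def)
  have red: "z [^] (n mod m) = z [^] n" if "z \<in> carrier G" "z [^] m = \<one>" for z and m n :: nat
  proof -
    have "z [^] (m * q + r) = z [^] r" for q r :: nat
      using that by (simp add: nat_pow_mult[symmetric] nat_pow_pow[symmetric])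
    from this[of "n div m" "n mod m"] show ?thesis by (simp only: mult_div_mod_eq)
  qed
  show ?thesis
  proof (rule that[of "b mod p" "a mod p\<^sup>2"])
    show "eval_word G f u = f Gen_y [^] (b mod p) \<otimes> f Gen_x [^] (a mod p\<^sup>2)"
      using red[OF _ Xp] red[OF _ Yp] ba by (simp add: X_def[symmetric] Y_def[symmetric])
  qed (use \<open>p > 0\<close> in auto)
qed

text \<open>The universal property gives a homomorphism \<open>h\<close> to the pairs, and the
  normal form map \<open>?n\<close> is its inverse. The relations reduce every word to a normal
  form, and applying \<open>h\<close> recovers the exponents, so distinct normal forms do not
  collapse.\<close>

lemma modular_p3_iso_modular_pairs:
  assumes "odd p" "p > 1"
  shows "modular_p3 p \<cong> modular_pairs p"
proof -
  define R where "R = {(replicate (p^2) letter_x, []), (replicate p letter_y, []),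
      ([letter_y_inv, letter_x, letter_y], replicate (p + 1) letter_x)}"
  define M where "M = modular_pairs p"
  define k where "k g = (case g of Gen_x \<Rightarrow> (0 :: nat, 1 :: nat) | Gen_y \<Rightarrow> (1, 0))" for g
  define f where "f g = word_class R [(g, True)]" for g
  have P: "modular_p3 p = presented_group R" by (simp add: modular_p3_def R_def)
  have R: "(replicate (p^2) letter_x, []) \<in> R" "(replicate p letter_y, []) \<in> R"
    "([letter_y_inv, letter_x, letter_y], replicate (p + 1) letter_x) \<in> R"
    by (simp_all add: R_def)
  interpret P: group "presented_group R" by (rule group_presented_group)
  interpret M: group M unfolding M_def by (rule group_modular_pairs[OF assms(2)])
  have p2: "1 < p\<^sup>2" using one_less_power[OF assms(2), of 2] by simp
  have kc: "range k \<subseteq> carrier M"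
    using assms(2) p2 by (auto simp: k_def M_def split: modular_gen.splits)
  have kx: "k Gen_x [^]\<^bsub>M\<^esub> n = (0, n mod p\<^sup>2)" and ky: "k Gen_y [^]\<^bsub>M\<^esub> n = (n mod p, 0)" for n :: nat
    by (simp_all add: k_def M_def modular_pairs_pow)
  \<comment> \<open>The conjugation relation is checked as \<open>x y = y x^(p + 1)\<close>, which
    avoids computing an inverse in the model.\<close>
  have "k Gen_x \<otimes>\<^bsub>M\<^esub> k Gen_y = k Gen_y \<otimes>\<^bsub>M\<^esub> k Gen_x [^]\<^bsub>M\<^esub> (p + 1)"
    unfolding kx by (simp add: k_def M_def)
  then have "inv\<^bsub>M\<^esub> (k Gen_y) \<otimes>\<^bsub>M\<^esub> (k Gen_x \<otimes>\<^bsub>M\<^esub> k Gen_y) = k Gen_x [^]\<^bsub>M\<^esub> (p + 1)"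
    using kc by (simp add: M.m_assoc[symmetric] image_subset_iff)
  then have rel: "eval_word M k u = eval_word M k v" if "(u, v) \<in> R" for u v
    using that kc unfolding R_def
    by (auto simp: M.eval_word_replicate kx ky image_subset_iff simp del: replicate_Suc) (simp_all add: M_def)
  obtain h where h: "h \<in> hom (presented_group R) M" "\<And>u. h (word_class R u) = eval_word M k u"
    using presented_group_hom_exists[OF M.is_group kc rel] by blast
  have hf: "h (f g) = k g" for g
    using kc by (simp add: f_def h(2) image_subset_iff)
  interpret h: group_hom "presented_group R" M h by unfold_locales (rule h(1))
  have fc: "range f \<subseteq> carrier (presented_group R)" by (auto simp: f_def word_class_closed)
  have rel_f: "eval_word (presented_group R) f u = eval_word (presented_group R) f v" if "(u, v) \<in> R" for u v
    using word_eq.rel[OF that] unfolding f_def by (simp only: word_class_eq_eval_word[symmetric] word_class_eq_iff)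
  let ?n = "\<lambda>(b :: nat, a :: nat). f Gen_y [^]\<^bsub>presented_group R\<^esub> b \<otimes>\<^bsub>presented_group R\<^esub> f Gen_x [^]\<^bsub>presented_group R\<^esub> a"
  have nf: "\<exists>z\<in>carrier M. A = ?n z" if A: "A \<in> carrier (presented_group R)" for A
  proof -
    obtain u where u: "A = word_class R u" using A by (auto simp: presented_group_carrier)
    have 1: "f Gen_x [^]\<^bsub>presented_group R\<^esub> p\<^sup>2 = \<one>\<^bsub>presented_group R\<^esub>"
      "f Gen_y [^]\<^bsub>presented_group R\<^esub> p = \<one>\<^bsub>presented_group R\<^esub>"
      using rel_f[OF R(1)] rel_f[OF R(2)] by (simp_all add: P.eval_word_replicate[OF fc])
    have 2: "inv\<^bsub>presented_group R\<^esub> (f Gen_y) \<otimes>\<^bsub>presented_group R\<^esub> f Gen_x \<otimes>\<^bsub>presented_group R\<^esub> f Gen_y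
      = f Gen_x [^]\<^bsub>presented_group R\<^esub> (p + 1)"
    proof -
      have "eval_word (presented_group R) f [letter_y_inv, letter_x, letter_y]
          = f Gen_x [^]\<^bsub>presented_group R\<^esub> (p + 1)"
        unfolding rel_f[OF R(3)] by (rule P.eval_word_replicate[OF fc])
      then show ?thesis using fc by (simp add: P.m_assoc image_subset_iff)
    qed
    obtain b a where "b < p" "a < p\<^sup>2" "eval_word (presented_group R) f u = ?n (b, a)"
      using P.eval_word_modular_normal_form[OF fc _ 1 2, of u] assms(2) by auto
    then show ?thesis
      unfolding u word_class_eq_eval_word[of R u] f_def[symmetric] by (intro bexI[of _ "(b, a)"]) (auto simp: M_def)
  qed
  have hn: "h (?n z) = z" if z': "z \<in> carrier M" for z
  proof -
    obtain b a where z: "z = (b, a)" "b < p" "a < p\<^sup>2" using z' by (cases z) (auto simp: M_def)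
    have "h (?n z) = k Gen_y [^]\<^bsub>M\<^esub> b \<otimes>\<^bsub>M\<^esub> k Gen_x [^]\<^bsub>M\<^esub> a"
      using fc by (simp add: z hf[symmetric] h.hom_nat_pow image_subset_iff)
    also have "\<dots> = z" unfolding kx ky using z by (simp add: M_def)
    finally show ?thesis .
  qed
  have nc: "?n z \<in> carrier (presented_group R)" for z
    using fc by (cases z) (simp add: image_subset_iff)
  have "bij_betw h (carrier (presented_group R)) (carrier M)"
  proof (rule bij_betwI[where g = ?n])
    show "?n (h A) = A" if "A \<in> carrier (presented_group R)" for A
      using nf[OF that] hn by auto
  qed (use hn nc in auto)
  then have "h \<in> iso (presented_group R) M" using h(1) by (simp add: iso_def)
  then show ?thesis by (auto simp: P M_def is_iso_def)
qed

lemma group_modular_p3: "group (modular_p3 p)"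
  unfolding modular_p3_def by (rule group_presented_group)

lemma cdeg_modular_p3:
  assumes "prime p" "odd p"
  shows "cdeg (modular_p3 p) = (real p + 1) / (real p + 2)"
proof -
  have p1: "p > 1" using assms prime_gt_1_nat by auto
  show ?thesis
    using iso_imp_cdeg_eq[OF group_modular_p3 group_modular_pairs[OF p1] modular_p3_iso_modular_pairs[OF assms(2) p1]]
    by (simp add: cdeg_modular_pairs[OF assms])
qed

lemma order_modular_p3:
  assumes "odd p" "p > 1"
  shows "order (modular_p3 p) = p ^ 3"
  using iso_same_card[OF modular_p3_iso_modular_pairs[OF assms]]
  by (simp add: order_def power2_eq_square power3_eq_cube)

lemma cdeg_product_modular_p3:
  assumes "finite Q" "\<And>q. q \<in> Q \<Longrightarrow> prime q \<and> odd q"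
  shows "cdeg (product_group Q modular_p3) = (\<Prod>q\<in>Q. (real q + 1) / (real q + 2))"
proof -
  have "order (modular_p3 q) = q ^ 3" if "q \<in> Q" for q
    using assms(2)[OF that] prime_gt_1_nat by (intro order_modular_p3) auto
  then have "cdeg (product_group Q modular_p3) = (\<Prod>q\<in>Q. cdeg (modular_p3 q))"
    using assms by (intro cdeg_product_group_coprime group_modular_p3)
      (auto simp: primes_coprime)
  also have "\<dots> = (\<Prod>q\<in>Q. (real q + 1) / (real q + 2))"
    using assms by (intro prod.cong) (auto simp: cdeg_modular_p3)
  finally show ?thesis .
qed

section \<open>Products over primes\<close>

text \<open>Expanding each \<open>1 / (1 - 1 / p)\<close> as a geometric series and multiplying out
  yields \<open>1 / a\<close> for every \<open>a\<close> with all prime factors in \<open>P\<close>.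
  The induction splits off one prime at a time, and a finite \<open>A\<close> keeps the sums
  finite.\<close>

lemma sum_inverse_smooth_le:
  assumes "finite P" "\<And>p. p \<in> P \<Longrightarrow> prime p" "finite A"
    and "\<And>a. a \<in> A \<Longrightarrow> a > 0 \<and> prime_factors a \<subseteq> P"
  shows "(\<Sum>a\<in>A. 1 / real a) \<le> (\<Prod>p\<in>P. 1 / (1 - 1 / real p))"
  using assms
proof (induction P arbitrary: A rule: finite_induct)
  case empty
  have "a = 1" if "a \<in> A" for a
    using empty.prems(3)[OF that] by (auto simp: prime_factorization_empty_iff)
  then have "A \<subseteq> {1}" by auto
  then have "(\<Sum>a\<in>A. 1 / real a) \<le> (\<Sum>a\<in>{1}. 1 / real a)"
    by (intro sum_mono2) auto
  then show ?case by simp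
next
  case (insert p P)
  have p: "prime p" "p > 1" using insert.prems(1)[of p] prime_gt_1_nat by auto
  \<comment> \<open>Separates the exponent of \<open>p\<close> in \<open>a\<close> from the cofactor
    prime to \<open>p\<close>, to which the induction hypothesis applies.\<close>
  let ?g = "\<lambda>a. (multiplicity p a, a div p ^ multiplicity p a)"
  define B where "B = (\<lambda>a. a div p ^ multiplicity p a) ` A"
  define N where "N = Max (multiplicity p ` A)"
  have dec: "a = p ^ multiplicity p a * (a div p ^ multiplicity p a)" for a
    by (simp add: multiplicity_dvd)
  have inj: "inj_on ?g A"
    by (intro inj_onI) (metis Pair_inject dec)
  have sub: "?g ` A \<subseteq> {..N} \<times> B"
    using \<open>finite A\<close> by (auto simp: B_def N_def)
  have B: "b > 0 \<and> prime_factors b \<subseteq> P" if b: "b \<in> B" for b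
  proof -
    obtain a where a: "a \<in> A" "b = a div p ^ multiplicity p a"
      using b by (auto simp: B_def)
    have "a > 0" "prime_factors a \<subseteq> insert p P" using insert.prems(3) a(1) by auto
    have ab: "a = p ^ multiplicity p a * b" using dec a(2) by simp
    then have "b > 0" using \<open>a > 0\<close> by (cases b) auto
    have "prime_factors b \<subseteq> prime_factors a"
      using ab \<open>a > 0\<close> by (metis dvd_prime_factors dvd_triv_right not_gr_zero)
    moreover have "\<not> p dvd b"
      using a(2) \<open>a > 0\<close> p by (simp add: multiplicity_decompose)
    ultimately show ?thesis
      using \<open>b > 0\<close> \<open>prime_factors a \<subseteq> insert p P\<close> by auto
  qed
  have "(\<Sum>a\<in>A. 1 / real a) = (\<Sum>a\<in>A. (\<lambda>(k, b). (1 / real p) ^ k * (1 / real b)) (?g a))"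
  proof (rule sum.cong[OF HOL.refl])
    fix a
    have "real a = real p ^ multiplicity p a * real (a div p ^ multiplicity p a)"
      by (metis dec of_nat_mult of_nat_power)
    then show "1 / real a = (\<lambda>(k, b). (1 / real p) ^ k * (1 / real b)) (?g a)"
      by (simp add: power_one_over)
  qed
  also have "\<dots> = (\<Sum>(k, b)\<in>?g ` A. (1 / real p) ^ k * (1 / real b))"
    by (simp add: sum.reindex[OF inj] o_def)
  \<comment> \<open>Filling up to a full rectangle adds nonnegative terms only and lets the double
    sum factor.\<close>
  also have "\<dots> \<le> (\<Sum>(k, b)\<in>{..N} \<times> B. (1 / real p) ^ k * (1 / real b))"
    using sub \<open>finite A\<close> by (intro sum_mono2) (auto simp: B_def)
  also have "\<dots> = (\<Sum>k\<le>N. (1 / real p) ^ k) * (\<Sum>b\<in>B. 1 / real b)"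
    by (simp only: sum.cartesian_product[symmetric] sum_product)
  also have "\<dots> \<le> (1 / (1 - 1 / real p)) * (\<Prod>p\<in>P. 1 / (1 - 1 / real p))"
  proof (intro mult_mono)
    show "(\<Sum>k\<le>N. (1 / real p) ^ k) \<le> 1 / (1 - 1 / real p)"
    proof -
      have "(\<Sum>k\<le>N. (1 / real p) ^ k) \<le> (\<Sum>k. (1 / real p) ^ k)"
        using p by (intro sum_le_suminf summable_geometric) auto
      then show ?thesis using p by (simp add: suminf_geometric)
    qed
    show "(\<Sum>b\<in>B. 1 / real b) \<le> (\<Prod>p\<in>P. 1 / (1 - 1 / real p))"
      using insert.IH[of B] insert.prems B \<open>finite A\<close> by (auto simp: B_def)
  qed (use p in \<open>auto intro!: sum_nonneg\<close>)
  finally show ?case using insert.hyps by simp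
qed

text \<open>All prime factors of a number up to \<open>n\<close> are at most \<open>n\<close>, so
  the reciprocal of the product over primes below \<open>Suc n\<close> is at least
  \<open>harm n\<close>, which diverges.\<close>

lemma prod_primes_tendsto_0: "(\<lambda>n. \<Prod>p | prime p \<and> p < n. 1 - 1 / real p) \<longlonglongrightarrow> 0"
proof -
  let ?P = "\<lambda>n. \<Prod>p | prime p \<and> p < n. 1 - 1 / real p"
  have pos: "?P n > 0" for n
    by (intro prod_pos) (auto dest: prime_gt_1_nat)
  have ub: "?P (Suc n) \<le> inverse (harm n)" if "n > 0" for n
  proof -
    have "(\<Sum>a\<in>{1..n}. 1 / real a) \<le> (\<Prod>p | prime p \<and> p < Suc n. 1 / (1 - 1 / real p))"
      by (rule sum_inverse_smooth_le) (auto simp: prime_factors_dvd less_Suc_eq_le dest: dvd_imp_le)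
    also have "\<dots> = inverse (?P (Suc n))"
      by (simp add: prod_dividef inverse_eq_divide)
    finally have le: "harm n \<le> inverse (?P (Suc n))"
      by (simp add: harm_def inverse_eq_divide)
    have "harm n > (0::real)" using that by (simp add: harm_pos)
    then show ?thesis using le_imp_inverse_le[OF le] by simp
  qed
  have "(\<lambda>n. inverse (harm n :: real)) \<longlonglongrightarrow> 0"
    by (rule tendsto_inverse_0_at_top[OF harm_at_top])
  then have "(\<lambda>n. ?P (Suc n)) \<longlonglongrightarrow> 0"
    by (rule tendsto_sandwich[rotated 3, where f = "\<lambda>_. 0"]) (use pos ub in \<open>auto simp: less_imp_le intro: eventually_sequentiallyI[of 1]\<close>)
  then show ?thesis by (rule LIMSEQ_imp_Suc)
qed

text \<open>A single factor \<open>1 - 1 / (q + 2)\<close> exceeds \<open>1 - 1 / q\<close>, but its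
  square does not. Discarding the primes below \<open>N\<close> only divides the Euler product by
  the fixed positive number \<open>?E N\<close>.\<close>

lemma prod_primes_ge_tendsto_0:
  fixes N :: nat
  assumes "N \<ge> 3"
  shows "(\<lambda>n. \<Prod>q | prime q \<and> N \<le> q \<and> q < n. (real q + 1) / (real q + 2)) \<longlonglongrightarrow> 0"
proof -
  let ?P = "\<lambda>n. \<Prod>q | prime q \<and> N \<le> q \<and> q < n. (real q + 1) / (real q + 2)"
  let ?E = "\<lambda>n. \<Prod>p | prime p \<and> p < n. 1 - 1 / real p"
  have pos: "?E n > 0" for n
    by (intro prod_pos) (auto dest: prime_gt_1_nat)
  have le: "(?P n)\<^sup>2 \<le> ?E n / ?E N" if "n \<ge> N" for n
  proof -
    have "(?P n)\<^sup>2 = (\<Prod>q | prime q \<and> N \<le> q \<and> q < n. ((real q + 1) / (real q + 2))\<^sup>2)"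
      by (simp add: prod_power_distrib)
    also have "\<dots> \<le> (\<Prod>q | prime q \<and> N \<le> q \<and> q < n. 1 - 1 / real q)"
    proof (intro prod_mono conjI)
      fix q assume "q \<in> {q. prime q \<and> N \<le> q \<and> q < n}"
      then have q: "real q \<ge> 3" using assms by auto
      \<comment> \<open>This is the difference of the two sides after clearing denominators. It is
        negative at 2, whence the bound \<open>N \<ge> 3\<close>.\<close>
      have "real q ^ 2 - real q - 4 \<ge> 0"
      proof -
        have "real q * (real q - 1) \<ge> 3 * (3 - 1)"
          using q by (intro mult_mono) auto
        then show ?thesis by (simp add: power2_eq_square algebra_simps)
      qed
      then have "(real q + 1)\<^sup>2 * real q \<le> (real q - 1) * (real q + 2)\<^sup>2"
        by (simp add: power2_eq_square algebra_simps)
      then show "((real q + 1) / (real q + 2))\<^sup>2 \<le> 1 - 1 / real q"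
        using q by (simp add: power_divide divide_simps split: if_splits)
    qed auto
    also have "\<dots> = ?E n / ?E N"
    proof -
      have "{p. prime p \<and> p < n} = {q. prime q \<and> N \<le> q \<and> q < n} \<union> {p. prime p \<and> p < N}"
        using that by auto
      then have "?E n = (\<Prod>q | prime q \<and> N \<le> q \<and> q < n. 1 - 1 / real q) * ?E N"
        by (simp only:) (rule prod.union_disjoint, auto)
      then show ?thesis using pos[of N] by simp
    qed
    finally show ?thesis .
  qed
  have "(\<lambda>n. ?E n / ?E N) \<longlonglongrightarrow> 0 / ?E N"
    using pos[of N] by (intro tendsto_divide prod_primes_tendsto_0) auto
  then have "(\<lambda>n. ?E n / ?E N) \<longlonglongrightarrow> 0" by simp
  then have "(\<lambda>n. (?P n)\<^sup>2) \<longlonglongrightarrow> 0"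
    by (rule tendsto_sandwich[rotated 3, where f = "\<lambda>_. 0"])
      (use le in \<open>auto simp: eventually_at_top_linorder\<close>)
  then show ?thesis by simp
qed

text \<open>Multiplying up the factors of consecutive primes \<open>q \<ge> N\<close> descends from 1 to 0 in steps of
  size less than \<open>1 / N\<close>, hence passes within \<open>1 / N\<close> of every point of the unit interval.\<close>

lemma prod_odd_primes_approx:
  fixes t e :: real
  assumes "0 < t" "t < 1" "e > 0"
  obtains Q :: "nat set" where "finite Q" "Q \<noteq> {}" "\<And>q. q \<in> Q \<Longrightarrow> prime q \<and> odd q"
    "\<bar>(\<Prod>q\<in>Q. (real q + 1) / (real q + 2)) - t\<bar> < e"
proof -
  obtain N0 :: nat where N0: "1 / e < real N0" using reals_Archimedean2 by blast
  \<comment> \<open>The lower bound 3 excludes the prime 2 and makes the convergence result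
    applicable.\<close>
  define N where "N = max 3 N0"
  have N: "N \<ge> 3" "1 / e < real N" using N0 by (auto simp: N_def)
  then have Ne: "1 / real N < e" using \<open>e > 0\<close> by (simp add: field_simps)
  define Q where "Q n = {q. prime q \<and> N \<le> q \<and> q < n}" for n
  define P where "P n = (\<Prod>q\<in>Q n. (real q + 1) / (real q + 2))" for n
  have fin: "finite (Q n)" for n by (simp add: Q_def)
  have "P \<longlonglongrightarrow> 0" using prod_primes_ge_tendsto_0[OF N(1)] by (simp add: P_def[abs_def] Q_def)
  then have "eventually (\<lambda>n. P n < t) sequentially" using \<open>0 < t\<close> by (rule order_tendstoD)
  then have ex: "\<exists>n. P n < t" by (auto simp: eventually_at_top_linorder)
  \<comment> \<open>At the first index below \<open>t\<close>, the preceding product is still at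
    least \<open>t\<close>, so \<open>t\<close> lies within one step.\<close>
  define n where "n = (LEAST n. P n < t)"
  have n: "P n < t" unfolding n_def by (rule LeastI_ex[OF ex])
  have "Q 0 = {}" by (auto simp: Q_def)
  then have "P 0 = 1" by (simp add: P_def)
  then obtain m where m: "n = Suc m" using n \<open>t < 1\<close> by (cases n) auto
  have Pm: "P m \<ge> t" using not_less_Least[of m "\<lambda>n. P n < t"] m by (auto simp: n_def)
  have bounds: "0 \<le> P m" "P m \<le> 1" unfolding P_def by (auto intro!: prod_nonneg prod_le_1)
  \<comment> \<open>The product has changed, so \<open>m\<close> itself is the prime that was
    added.\<close>
  have "Q n \<noteq> Q m" using n Pm by (auto simp: P_def)
  then have Qn: "Q n = insert m (Q m)" "m \<ge> N" by (auto simp: Q_def m less_Suc_eq)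
  have "m \<notin> Q m" by (simp add: Q_def)
  then have "P n = (1 - 1 / (real m + 2)) * P m"
    using Qn fin by (simp add: P_def field_simps)
  then have "P m - P n = P m / (real m + 2)" by (simp add: algebra_simps)
  also have "\<dots> \<le> 1 / real N"
    using bounds Qn(2) N(1) by (intro frac_le) auto
  finally have "\<bar>P n - t\<bar> < e" using Ne n Pm by linarith
  moreover have "prime q \<and> odd q" if "q \<in> Q n" for q
    using that N(1) prime_odd_nat by (auto simp: Q_def)
  ultimately show ?thesis
    using that[of "Q n"] fin Qn(1) by (simp add: P_def)
qed

section \<open>Density of the cyclicity degrees\<close>

text \<open>Containment of the products is up to isomorphism, since the groups in \<open>M\<close>
  live on the type \<open>'a\<close>, while the products consist of functions into sets of
  words.\<close>

theorem theorem3p2: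
  fixes M :: "'a monoid set"
  assumes "\<And>G. G \<in> M \<Longrightarrow> group G \<and> finite (carrier G)"
    and "\<And>Q :: nat set. \<lbrakk>finite Q; Q \<noteq> {}; \<And>q. q \<in> Q \<Longrightarrow> prime q \<and> odd q\<rbrakk>
           \<Longrightarrow> \<exists>G\<in>M. G \<cong> product_group Q modular_p3"
  shows "closure (CD M) = {0..1}"
proof
  have "CD M \<subseteq> {0..1}"
    unfolding CD_def using cdeg_bounds assms(1) by blast
  then show "closure (CD M) \<subseteq> {0..1}"
    by (rule closure_minimal) simp
  \<comment> \<open>Interior points suffice: the closure of the open interval contains both
    endpoints.\<close>
  have "t \<in> closure (CD M)" if t: "t \<in> {0<..<1}" for t :: real
    unfolding closure_approachable
  proof (intro allI impI)
    fix e :: real assume "e > 0"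
    then obtain Q :: "nat set" where Q: "finite Q" "Q \<noteq> {}" "\<And>q. q \<in> Q \<Longrightarrow> prime q \<and> odd q"
      "\<bar>(\<Prod>q\<in>Q. (real q + 1) / (real q + 2)) - t\<bar> < e"
      using prod_odd_primes_approx t by (metis greaterThanLessThan_iff)
    obtain G where G: "G \<in> M" "G \<cong> product_group Q modular_p3"
      using assms(2)[OF Q(1-3)] by blast
    have "cdeg G = cdeg (product_group Q modular_p3)"
      using assms(1)[OF G(1)] G(2) by (intro iso_imp_cdeg_eq product_group group_modular_p3) auto
    also have "\<dots> = (\<Prod>q\<in>Q. (real q + 1) / (real q + 2))"
      by (rule cdeg_product_modular_p3[OF Q(1,3)])
    finally have "dist (cdeg G) t < e" using Q(4) by (simp add: dist_real_def)
    then show "\<exists>y\<in>CD M. dist y t < e" using G(1) by (auto simp: CD_def)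
  qed
  then have "closure {0<..<1::real} \<subseteq> closure (CD M)"
    by (intro closure_minimal closed_closure) blast
  then show "{0..1} \<subseteq> closure (CD M)" by simp
qed

end
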